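(* Let $X, Y$ be Banach spaces, $D_F \subseteq X$ open, $F : D_F \to Y$ a continuously Fréchet-differentiable operator, and $B \in L(Y,X)$ an invertible bounded linear operator. Put $T(x) = x - BF(x)$ for $x\in D_F$. Let $x_0 \in D_F$ and let $\eta > 0$, $0 \le \nu < 1$, $R > 0$ be constants with $\bar B(x_0,R) \subset D_F$, and let $\omega_B : [0,R] \to [0,\infty)$ be a continuous non-decreasing function with $\omega_B(0) = \nu$ such that $$\|BF'(x) - I\| \le \omega_B(\|x - x_0\|) \quad \text{for all } x \in \bar B(x_0,R), \qquad \|BF(x_0)\| \le \eta .$$ Define $$\phi(\upsilon) = \eta + \nu\,\upsilon + \int_0^{\upsilon} \big(\omega_B(l) - \nu\big)\,dl, \quad \upsilon \in [0,R],$$ and $\gamma_* = \sup\{\gamma \in (0,R] : \omega_B(\gamma) < 1\}$, and assume that $\phi(\gamma_* ) \le \gamma_*$. Let $\{\upsilon_k\}$ be the scalar sequence defined by $\upsilon_0 = 0$, $\upsilon_{k+1} = \phi(\upsilon_k)$ for $k\ge 0$. Then: (1) The equation $\upsilon = \phi(\upsilon)$ has a minimal solution $\upsilon_*$ in $[0,R]$, and $\upsilon_* \le \gamma_*$. The sequence $\{\upsilon_k\}$ is non-decreasing, remains in $[0,\upsilon_*]$ and converges to $\upsilon_*$. (2) The sequence $x_{k+1} = T(x_k)$, $k \ge 0$, started at $x_0$, is well-defined, remains in $\bar B(x_0,\upsilon_* )$ and converges to a solution $x_*$ of the equation $BF(x) = 0$. Moreover, for all $k \ge 0$, $$\|x_{k+1}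 - x_k\| \le \upsilon_{k+1} - \upsilon_k, \qquad \|x_* - x_k\| \le \upsilon_* - \upsilon_k .$$ (3) Let $\Lambda$ be the set of all $\lambda \in (\upsilon_*, R]$ such that $\phi(\upsilon) - \upsilon < 0$ for all $\upsilon \in (\upsilon_*,\lambda)$, and let $\lambda_* = \sup \Lambda$ if $\Lambda \ne \emptyset$ and $\lambda_* = \upsilon_*$ if $\Lambda = \emptyset$. If either $\lambda_* = \upsilon_*$, or both $\lambda_* > \upsilon_*$ and $\phi(\lambda_* ) < \lambda_*$, then $x_*$ is the unique solution of $BF(x)=0$ in the closed ball $U = \bar B(x_0,\lambda_* )$. If $\lambda_* > \upsilon_*$ and $\phi(\lambda_* ) = \lambda_*$, then $x_*$ is the unique solution of $BF(x)=0$ in the open ball $U = B(x_0,\lambda_* )$. (4) In each of the two cases of (3), for every $\tilde x_0$ in the corresponding uniqueness ball $U$, the sequence $\tilde x_k = T^k \tilde x_0$ converges to $x_*$.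
   Context: $B(x_0,r)$ and $\bar B(x_0,r)$ denote the open and closed balls in $X$ with center $x_0$ and radius $r$. $L(Y,X)$ is the space of bounded linear operators from $Y$ to $X$ with the operator norm, and $I$ is the identity operator on $X$. $F'(x)$ is the Fréchet derivative of $F$ at $x$; "continuously Fréchet-differentiable" means that $F$ is Fréchet-differentiable on $D_F$ and $x \mapsto F'(x)$ is continuous in operator norm. $T^k$ is the $k$-fold iterate of $T$. *)

theory Defs
  imports "HOL-Analysis.Analysis"
begin

definition invertible_blinfun ::
    "('b::real_normed_vector \<Rightarrow>\<^sub>L 'a::real_normed_vector) \<Rightarrow> bool" where
  "invertible_blinfun B \<longleftrightarrow>
     (\<exists>C :: 'a \<Rightarrow>\<^sub>L 'b. B o\<^sub>L C = id_blinfun \<and> C o\<^sub>L B = id_blinfun)"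

(* A map on D is represented by a total function. D is open in all uses, so that
   the derivative only depends on the values of F on D, and F' is unique on D. *)
definition C1_on_with_derivative ::
    "('a::real_normed_vector \<Rightarrow> 'b::real_normed_vector) \<Rightarrow> ('a \<Rightarrow> 'a \<Rightarrow>\<^sub>L 'b) \<Rightarrow> 'a set \<Rightarrow> bool" where
  "C1_on_with_derivative F F' D \<longleftrightarrow>
     (\<forall>x\<in>D. (F has_derivative blinfun_apply (F' x)) (at x)) \<and> continuous_on D F'"

definition fixed_point_map ::
    "('b::real_normed_vector \<Rightarrow>\<^sub>L 'a::real_normed_vector) \<Rightarrow> ('a \<Rightarrow> 'b) \<Rightarrow> 'a \<Rightarrow> 'a" where
  "fixed_point_map B F x = x - blinfun_apply B (F x)"

definition majorant :: "(real \<Rightarrow> real) \<Rightarrow> real \<Rightarrow> real \<Rightarrow> real \<Rightarrow> real" where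
  "majorant \<omega> \<nu> \<eta> v = \<eta> + \<nu> * v + integral {0..v} (\<lambda>l. \<omega> l - \<nu>)"

definition gamma_star :: "(real \<Rightarrow> real) \<Rightarrow> real \<Rightarrow> real" where
  "gamma_star \<omega> R = Sup {\<gamma>. 0 < \<gamma> \<and> \<gamma> \<le> R \<and> \<omega> \<gamma> < 1}"

definition least_fixpoint_in :: "(real \<Rightarrow> real) \<Rightarrow> real set \<Rightarrow> real \<Rightarrow> bool" where
  "least_fixpoint_in f S v \<longleftrightarrow> v \<in> S \<and> v = f v \<and> (\<forall>u\<in>S. u = f u \<longrightarrow> v \<le> u)"

definition Lambda_set :: "(real \<Rightarrow> real) \<Rightarrow> real \<Rightarrow> real \<Rightarrow> real set" where
  "Lambda_set \<phi> R v\<^sub>s =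
     {l. v\<^sub>s < l \<and> l \<le> R \<and> (\<forall>v. v\<^sub>s < v \<and> v < l \<longrightarrow> \<phi> v - v < 0)}"

definition lambda_star :: "(real \<Rightarrow> real) \<Rightarrow> real \<Rightarrow> real \<Rightarrow> real" where
  "lambda_star \<phi> R v\<^sub>s =
     (if Lambda_set \<phi> R v\<^sub>s \<noteq> {} then Sup (Lambda_set \<phi> R v\<^sub>s) else v\<^sub>s)"

(* Membership in D is part of being a solution, as F is only given on D. *)
definition solution :: "('b::real_normed_vector \<Rightarrow>\<^sub>L 'a::real_normed_vector) \<Rightarrow>
    ('a \<Rightarrow> 'b) \<Rightarrow> 'a set \<Rightarrow> 'a \<Rightarrow> bool" where
  "solution B F D x \<longleftrightarrow> x \<in> D \<and> blinfun_apply B (F x) = 0"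

definition unique_solution_in :: "('b::real_normed_vector \<Rightarrow>\<^sub>L 'a::real_normed_vector) \<Rightarrow>
    ('a \<Rightarrow> 'b) \<Rightarrow> 'a set \<Rightarrow> 'a set \<Rightarrow> 'a \<Rightarrow> bool" where
  "unique_solution_in B F D U x \<longleftrightarrow>
     x \<in> U \<and> solution B F D x \<and> (\<forall>y\<in>U. solution B F D y \<longrightarrow> y = x)"

(* The iterates of T are defined only as long as they stay in D. *)
definition iterates_converge_in :: "('a::real_normed_vector \<Rightarrow> 'a) \<Rightarrow> 'a set \<Rightarrow> 'a \<Rightarrow> 'a \<Rightarrow> bool" where
  "iterates_converge_in T D y x \<longleftrightarrow>
     (\<forall>k. (T ^^ k) y \<in> D) \<and> (\<lambda>k. (T ^^ k) y) \<longlonglongrightarrow> x"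

end

theory Submission
  imports Defs
begin

text \<open>
  The scalar function \<open>\<phi>\<close> majorizes \<open>T\<close>: since \<open>\<phi>' = \<omega>\<close> bounds the norm of
  \<open>T' = I - B F'\<close> on spheres around \<open>x\<^sub>0\<close>, integrating along a segment shows that
  \<open>\<parallel>x - x\<^sub>0\<parallel> \<le> u\<close> and \<open>\<parallel>y - x\<parallel> \<le> w - u\<close> imply \<open>\<parallel>T y - T x\<parallel> \<le> \<phi> w - \<phi> u\<close>
  (\<open>fixed_point_map_increment_le\<close>). Together with \<open>\<parallel>T x\<^sub>0 - x\<^sub>0\<parallel> \<le> \<phi> 0\<close>, this inequality
  and the continuity of \<open>\<phi>\<close> carry the whole theorem; they are the locale \<open>majorized_map\<close>.

  The hypotheses on the pair \<open>x, y\<close> and the radii \<open>u, w\<close> reproduce themselves when \<open>T\<close> is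
  applied to the points and \<open>\<phi>\<close> to the radii (\<open>majorized_step\<close>), so that any two orbits of
  \<open>T\<close> are at most as far apart as the corresponding orbits of \<open>\<phi>\<close> on the line. There, monotone
  iteration converges to a fixed point. The orbit of \<open>0\<close> converges to the least fixed point
  \<open>v\<^sub>s\<close>, which makes the orbit of \<open>x\<^sub>0\<close> a Cauchy sequence. If \<open>\<phi> w \<le> w\<close> and \<open>\<phi>\<close> has no fixed
  point in \<open>(v\<^sub>s, w]\<close>, the orbit of \<open>w\<close> decreases to \<open>v\<^sub>s\<close> as well, and the orbit of any point at
  distance at most \<open>w\<close> from \<open>x\<^sub>0\<close> is squeezed to the limit of the orbit of \<open>x\<^sub>0\<close>
  (\<open>orbits_converge\<close>). Uniqueness follows by applying this to the constant orbit of a solution.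
\<close>

section \<open>Iteration of monotone real functions\<close>

lemma monotone_iteration_converges:
  fixes f :: "real \<Rightarrow> real"
  assumes cont: "continuous_on {a..b} f" and mono: "mono_on {a..b} f"
    and self: "f ` {a..b} \<subseteq> {a..b}" and x: "x \<in> {a..b}"
  obtains p where "p \<in> {a..b}" "f p = p" "(\<lambda>k. (f ^^ k) x) \<longlonglongrightarrow> p"
proof -
  have mem: "(f ^^ k) x \<in> {a..b}" for k
  proof (induction k)
    case (Suc k)
    then show ?case using self by (simp add: image_subset_iff)
  qed (use x in simp)
  have "monoseq (\<lambda>k. (f ^^ k) x)"
  proof (cases "x \<le> f x")
    case True
    have "(f ^^ k) x \<le> (f ^^ Suc k) x" for k
    proof (induction k)
      case (Suc k)
      then show ?case
        using mono_onD[OF mono mem[of k] mem[of "Suc k"]] by simp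
    qed (use True in simp)
    then show ?thesis by (rule mono_SucI1[rule_format])
  next
    case False
    have "(f ^^ Suc k) x \<le> (f ^^ k) x" for k
    proof (induction k)
      case (Suc k)
      then show ?case
        using mono_onD[OF mono mem[of "Suc k"] mem[of k]] by simp
    qed (use False in simp)
    then show ?thesis by (rule mono_SucI2[rule_format])
  qed
  moreover have "norm ((f ^^ k) x) \<le> max \<bar>a\<bar> \<bar>b\<bar>" for k
    using mem[of k] unfolding real_norm_def atLeastAtMost_iff by linarith
  then have "Bseq (\<lambda>k. (f ^^ k) x)" by (rule BseqI')
  ultimately obtain p where p: "(\<lambda>k. (f ^^ k) x) \<longlonglongrightarrow> p"
    using Bseq_monoseq_convergent unfolding convergent_def by blast
  have pm: "p \<in> {a..b}"
    by (rule closed_sequentially[OF _ _ p]) (use mem in auto)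
  have "(\<lambda>k. f ((f ^^ k) x)) \<longlonglongrightarrow> f p"
    by (rule continuous_on_tendsto_compose[OF cont p pm]) (use mem in auto)
  moreover have "(\<lambda>k. f ((f ^^ k) x)) \<longlonglongrightarrow> p"
    using LIMSEQ_Suc[OF p] by simp
  ultimately have "f p = p" using LIMSEQ_unique by blast
  then show thesis using that pm p by blast
qed

section \<open>Maps with a scalar majorant\<close>

locale majorized_map =
  fixes T :: "'a::banach \<Rightarrow> 'a" and x0 :: 'a and \<phi> :: "real \<Rightarrow> real" and R :: real
  assumes increment_le:
      "\<lbrakk>0 \<le> u; u \<le> w; w \<le> R; norm (x - x0) \<le> u; norm (y - x) \<le> w - u\<rbrakk>
        \<Longrightarrow> norm (T y - T x) \<le> \<phi> w - \<phi> u"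
    and start: "norm (T x0 - x0) \<le> \<phi> 0"
    and cont: "continuous_on {0..R} \<phi>"
begin

text \<open>Monotonicity is the majorant inequality for \<open>x = y = x0\<close>.\<close>

lemma mono: "\<lbrakk>0 \<le> u; u \<le> w; w \<le> R\<rbrakk> \<Longrightarrow> \<phi> u \<le> \<phi> w"
  using increment_le[of u w x0 x0] by simp

lemma nonneg: "\<lbrakk>0 \<le> u; u \<le> R\<rbrakk> \<Longrightarrow> 0 \<le> \<phi> u"
  using mono[of 0 u] norm_ge_zero[of "T x0 - x0"] start by linarith

text \<open>The centre stays at \<open>x0\<close> although \<open>x\<close> moves: \<open>T x\<close> is within \<open>\<phi> u - \<phi> 0\<close> of
  \<open>T x0\<close>, which in turn is within \<open>\<phi> 0\<close> of \<open>x0\<close>.\<close>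

lemma majorized_step:
  assumes "0 \<le> u" "u \<le> w" "w \<le> R" "norm (x - x0) \<le> u" "norm (y - x) \<le> w - u"
  shows "0 \<le> \<phi> u" "\<phi> u \<le> \<phi> w" "norm (T x - x0) \<le> \<phi> u" "norm (T y - T x) \<le> \<phi> w - \<phi> u"
proof -
  show "0 \<le> \<phi> u" "\<phi> u \<le> \<phi> w" "norm (T y - T x) \<le> \<phi> w - \<phi> u"
    using assms nonneg mono increment_le by auto
  have "norm (T x - T x0) \<le> \<phi> u - \<phi> 0"
    using increment_le[of 0 u x0 x] assms by simp
  then show "norm (T x - x0) \<le> \<phi> u"
    using start norm_triangle_ineq[of "T x - T x0" "T x0 - x0"] by simp
qed

lemma majorized_orbits:
  assumes "0 \<le> u" "u \<le> w" "norm (x - x0) \<le> u" "norm (y - x) \<le> w - u"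
    and R: "\<And>k. (\<phi> ^^ k) w \<le> R"
  shows "0 \<le> (\<phi> ^^ k) u \<and> (\<phi> ^^ k) u \<le> (\<phi> ^^ k) w \<and> norm ((T ^^ k) x - x0) \<le> (\<phi> ^^ k) u
    \<and> norm ((T ^^ k) y - (T ^^ k) x) \<le> (\<phi> ^^ k) w - (\<phi> ^^ k) u"
proof (induction k)
  case (Suc k)
  then show ?case
    using majorized_step[of "(\<phi> ^^ k) u" "(\<phi> ^^ k) w" "(T ^^ k) x" "(T ^^ k) y"] R[of k] by simp
qed (use assms in simp)

text \<open>By monotonicity the orbit of \<open>0\<close> stays below every \<open>u\<close> with \<open>\<phi> u \<le> u\<close>. Hence it is
  bounded by \<open>g\<close>, and its limit is below every fixed point.\<close>

lemma scalar_iteration_converges: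
  assumes g: "0 \<le> g" "g \<le> R" "\<phi> g \<le> g"
  obtains v where "0 \<le> v" "v \<le> g" "\<phi> v = v" "\<And>u. \<lbrakk>0 \<le> u; u \<le> R; \<phi> u = u\<rbrakk> \<Longrightarrow> v \<le> u"
    "incseq (\<lambda>k. (\<phi> ^^ k) 0)" "\<And>k. 0 \<le> (\<phi> ^^ k) 0 \<and> (\<phi> ^^ k) 0 \<le> v"
    "(\<lambda>k. (\<phi> ^^ k) 0) \<longlonglongrightarrow> v"
proof -
  have below: "0 \<le> (\<phi> ^^ k) 0 \<and> (\<phi> ^^ k) 0 \<le> u" if "0 \<le> u" "u \<le> R" "\<phi> u \<le> u" for u k
  proof (induction k)
    case (Suc k)
    then show ?case
      using mono[of "(\<phi> ^^ k) 0" u] nonneg[of "(\<phi> ^^ k) 0"] that by auto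
  qed (use that in simp)
  have "\<phi> u \<in> {0..g}" if "u \<in> {0..g}" for u
    using that g mono[of u g] nonneg[of u] by auto
  then have self: "\<phi> ` {0..g} \<subseteq> {0..g}" by blast
  have cont_g: "continuous_on {0..g} \<phi>"
    by (rule continuous_on_subset[OF cont]) (use g in auto)
  have mono_g: "mono_on {0..g} \<phi>"
    using mono g by (auto simp: mono_on_def)
  obtain v where v: "v \<in> {0..g}" "\<phi> v = v" "(\<lambda>k. (\<phi> ^^ k) 0) \<longlonglongrightarrow> v"
    using monotone_iteration_converges[OF cont_g mono_g self, of 0] g by auto
  have "(\<phi> ^^ k) 0 \<le> (\<phi> ^^ Suc k) 0" for k
  proof (induction k)
    case (Suc k)
    then show ?case
      using mono[of "(\<phi> ^^ k) 0" "(\<phi> ^^ Suc k) 0"] below[OF g, of k] below[OF g, of "Suc k"] g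
      by simp
  qed (use nonneg[of 0] g in simp)
  then have "incseq (\<lambda>k. (\<phi> ^^ k) 0)" by (rule incseq_SucI)
  moreover have "v \<le> u" if "0 \<le> u" "u \<le> R" "\<phi> u = u" for u
    by (rule LIMSEQ_le_const2[OF v(3)]) (use below[of u] that in auto)
  moreover have "0 \<le> (\<phi> ^^ k) 0 \<and> (\<phi> ^^ k) 0 \<le> v" for k
    using below[of v] v g by auto
  ultimately show thesis using that v by auto
qed

text \<open>The orbit of \<open>x0\<close> is compared with itself, shifted by \<open>m\<close>: the pair \<open>x0\<close>,
  \<open>(T ^^ m) x0\<close> has the admissible radii \<open>0\<close>, \<open>(\<phi> ^^ m) 0\<close>. The limit is fixed by the
  majorant inequality itself, which provides the continuity of \<open>T\<close> that is needed.\<close>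

lemma orbit_of_centre_converges:
  assumes v: "0 \<le> v" "v \<le> R" "\<phi> v = v" and below: "\<And>k. (\<phi> ^^ k) 0 \<le> v"
    and lim: "(\<lambda>k. (\<phi> ^^ k) 0) \<longlonglongrightarrow> v"
  obtains p where "T p = p" "(\<lambda>k. (T ^^ k) x0) \<longlonglongrightarrow> p"
    "\<And>k. norm ((T ^^ k) x0 - x0) \<le> (\<phi> ^^ k) 0"
    "\<And>k. norm ((T ^^ Suc k) x0 - (T ^^ k) x0) \<le> (\<phi> ^^ Suc k) 0 - (\<phi> ^^ k) 0"
    "\<And>k. norm (p - (T ^^ k) x0) \<le> v - (\<phi> ^^ k) 0"
proof -
  have radius: "0 \<le> (\<phi> ^^ k) 0 \<and> norm ((T ^^ k) x0 - x0) \<le> (\<phi> ^^ k) 0" for k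
    using majorized_orbits[of 0 0 x0 x0 k] order_trans[OF below v(2)] by auto
  have shift: "norm ((T ^^ (k + m)) x0 - (T ^^ k) x0) \<le> (\<phi> ^^ (k + m)) 0 - (\<phi> ^^ k) 0" for k m
  proof -
    have "(\<phi> ^^ j) ((\<phi> ^^ m) 0) \<le> R" for j
      using below[of "j + m"] v(2) by (simp add: funpow_add)
    then show ?thesis
      using majorized_orbits[of 0 "(\<phi> ^^ m) 0" x0 "(T ^^ m) x0" k] radius[of m]
      by (simp add: funpow_add)
  qed
  have tail: "norm ((T ^^ (k + m)) x0 - (T ^^ k) x0) \<le> v - (\<phi> ^^ k) 0" for k m
    using shift[of k m] below[of "k + m"] by linarith
  have "Cauchy (\<lambda>k. (T ^^ k) x0)"
  proof (rule CauchyI')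
    fix e :: real assume "e > 0"
    then obtain N where N: "\<And>k. k \<ge> N \<Longrightarrow> v - (\<phi> ^^ k) 0 < e"
      using LIMSEQ_D[OF lim, of e] by (fastforce simp: abs_less_iff)
    have "norm ((T ^^ k) x0 - (T ^^ n) x0) < e" if "k \<ge> N" "n > k" for k n
      using tail[of k "n - k"] N[of k] that by (simp add: norm_minus_commute)
    then show "\<exists>N. \<forall>k\<ge>N. \<forall>n>k. dist ((T ^^ k) x0) ((T ^^ n) x0) < e"
      unfolding dist_norm
      by blast
  qed
  then obtain p where p: "(\<lambda>k. (T ^^ k) x0) \<longlonglongrightarrow> p"
    using Cauchy_convergent convergent_def by blast
  have err: "norm (p - (T ^^ k) x0) \<le> v - (\<phi> ^^ k) 0" for k
  proof (rule LIMSEQ_le_const2)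
    show "(\<lambda>m. norm ((T ^^ (k + m)) x0 - (T ^^ k) x0)) \<longlonglongrightarrow> norm (p - (T ^^ k) x0)"
      using LIMSEQ_ignore_initial_segment[OF p, of k]
      by (intro tendsto_intros) (simp add: add.commute)
  qed (use tail in auto)
  have "(\<lambda>k. (T ^^ Suc k) x0) \<longlonglongrightarrow> T p"
  proof (rule metric_LIMSEQ_I)
    fix e :: real assume "e > 0"
    then obtain N where N: "\<And>k. k \<ge> N \<Longrightarrow> v - (\<phi> ^^ Suc k) 0 < e"
      using LIMSEQ_D[OF LIMSEQ_Suc[OF lim], of e] by (fastforce simp: abs_less_iff)
    have "dist ((T ^^ Suc k) x0) (T p) < e" if "k \<ge> N" for k
      using increment_le[of "(\<phi> ^^ k) 0" v "(T ^^ k) x0" p] radius[of k] below[of k] err[of k]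
        v N[OF that] by (simp add: dist_norm norm_minus_commute)
    then show "\<exists>N. \<forall>k\<ge>N. dist ((T ^^ Suc k) x0) (T p) < e" by blast
  qed
  then have "T p = p" using LIMSEQ_Suc[OF p] LIMSEQ_unique by blast
  then show thesis
    using that[OF _ p] radius shift[of _ 1] err by simp
qed

text \<open>Comparison of the orbits of \<open>y\<close> and \<open>x0\<close> with the radii \<open>0\<close> and \<open>w\<close>: both scalar orbits
  tend to \<open>v\<close>, one from below and one from above.\<close>

lemma orbits_converge:
  assumes v: "0 \<le> v" "\<phi> v = v" and lim: "(\<lambda>k. (\<phi> ^^ k) 0) \<longlonglongrightarrow> v"
    and p: "(\<lambda>k. (T ^^ k) x0) \<longlonglongrightarrow> p"
    and w: "v \<le> w" "w \<le> R" "\<phi> w \<le> w" and only: "\<And>u. \<lbrakk>v < u; u \<le> w\<rbrakk> \<Longrightarrow> \<phi> u \<noteq> u"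
    and y: "norm (y - x0) \<le> w"
  shows "(T ^^ k) y \<in> cball x0 R" and "(\<lambda>k. (T ^^ k) y) \<longlonglongrightarrow> p"
proof -
  have self: "\<phi> u \<in> {v..w}" if "u \<in> {v..w}" for u
    using that v w mono[of u w] mono[of v u] unfolding atLeastAtMost_iff by linarith
  then have self': "\<phi> ` {v..w} \<subseteq> {v..w}" by blast
  have cont_w: "continuous_on {v..w} \<phi>"
    by (rule continuous_on_subset[OF cont]) (use v w in auto)
  have mono_w: "mono_on {v..w} \<phi>"
    unfolding mono_on_def atLeastAtMost_iff
    using mono v(1) w(2) by (meson order_trans)
  obtain q where q: "q \<in> {v..w}" "\<phi> q = q" "(\<lambda>k. (\<phi> ^^ k) w) \<longlonglongrightarrow> q"
    using monotone_iteration_converges[OF cont_w mono_w self', of w] w(1) by auto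
  have "q = v"
    using only[of q] q(1,2) by (cases "q = v") auto
  have "(\<phi> ^^ k) w \<in> {v..w}" for k
  proof (induction k)
    case (Suc k)
    then show ?case using self by simp
  qed (use w in simp)
  then have top: "(\<phi> ^^ k) w \<le> R" for k
    using w(2) by (meson atLeastAtMost_iff order_trans)
  have near: "norm ((T ^^ k) x0 - x0) \<le> (\<phi> ^^ k) 0"
    "norm ((T ^^ k) y - (T ^^ k) x0) \<le> (\<phi> ^^ k) w - (\<phi> ^^ k) 0" for k
    using majorized_orbits[of 0 w x0 y k, OF _ _ _ _ top] v(1) w(1) y by simp_all
  show "(T ^^ k) y \<in> cball x0 R"
    using near[of k] top[of k] norm_triangle_ineq[of "(T ^^ k) y - (T ^^ k) x0" "(T ^^ k) x0 - x0"]
    by (simp add: dist_norm norm_minus_commute)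
  have "(\<lambda>k. (\<phi> ^^ k) w - (\<phi> ^^ k) 0) \<longlonglongrightarrow> 0"
    using tendsto_diff[OF q(3) lim] \<open>q = v\<close> by simp
  then have "(\<lambda>k. (T ^^ k) y - (T ^^ k) x0) \<longlonglongrightarrow> 0"
    by (rule Lim_null_comparison[rotated]) (use near in auto)
  then show "(\<lambda>k. (T ^^ k) y) \<longlonglongrightarrow> p"
    using tendsto_add[OF _ p, of "\<lambda>k. (T ^^ k) y - (T ^^ k) x0" 0] by simp
qed

end

section \<open>The integral majorant\<close>

lemma majorant_has_derivative:
  assumes "continuous_on {0..R} \<omega>" "v \<in> {0..R}"
  shows "(majorant \<omega> \<nu> \<eta> has_real_derivative \<omega> v) (at v within {0..R})"
proof -
  have "((\<lambda>v. integral {0..v} (\<lambda>l. \<omega> l - \<nu>)) has_real_derivative \<omega> v - \<nu>) (at v within {0..R})"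
    by (rule integral_has_real_derivative) (use assms in \<open>auto intro!: continuous_intros\<close>)
  then have "((\<lambda>v. \<eta> + \<nu> * v + integral {0..v} (\<lambda>l. \<omega> l - \<nu>)) has_real_derivative
      0 + \<nu> * 1 + (\<omega> v - \<nu>)) (at v within {0..R})"
    by (auto intro!: derivative_eq_intros)
  then show ?thesis unfolding majorant_def by simp
qed

text \<open>On the segment from \<open>x\<close> to \<open>y\<close> the distance to \<open>x\<^sub>0\<close> at time \<open>t\<close> is at most \<open>u + t (w - u)\<close>,
  so the speed of \<open>T\<close> along the segment is at most the derivative of
  \<open>t \<mapsto> \<phi> (u + t (w - u))\<close>.\<close>

lemma fixed_point_map_increment_le:
  fixes F :: "'a::real_normed_vector \<Rightarrow> 'b::real_normed_vector" and B :: "'b \<Rightarrow>\<^sub>L 'a"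
  assumes der: "\<And>x. x \<in> cball x0 R \<Longrightarrow> (F has_derivative blinfun_apply (F' x)) (at x)"
    and cont: "continuous_on {0..R} \<omega>" and mono: "mono_on {0..R} \<omega>"
    and nonneg: "\<And>l. l \<in> {0..R} \<Longrightarrow> 0 \<le> \<omega> l"
    and bound: "\<And>x. x \<in> cball x0 R \<Longrightarrow> norm ((B o\<^sub>L F' x) - id_blinfun) \<le> \<omega> (norm (x - x0))"
    and uw: "0 \<le> u" "u \<le> w" "w \<le> R"
    and x: "norm (x - x0) \<le> u" and y: "norm (y - x) \<le> w - u"
  shows "norm (fixed_point_map B F y - fixed_point_map B F x)
    \<le> majorant \<omega> \<nu> \<eta> w - majorant \<omega> \<nu> \<eta> u"
proof (cases "u = w")
  case True
  then show ?thesis using y by simp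
next
  case False
  let ?T = "fixed_point_map B F" and ?m = "majorant \<omega> \<nu> \<eta>"
  define c where "c t = x + t *\<^sub>R (y - x)" for t :: real
  define s where "s t = u + t * (w - u)" for t :: real
  have s: "0 \<le> s t \<and> s t \<le> R" if "t \<in> {0..1}" for t
    using that uw mult_left_le_one_le[of "w - u" t] mult_nonneg_nonneg[of t "w - u"]
    unfolding s_def atLeastAtMost_iff by linarith
  have s_in: "s t \<in> {0<..<R}" if "t \<in> {0<..<1}" for t
  proof -
    have "t * (w - u) < 1 * (w - u)" "0 < t * (w - u)"
      using that uw False by (auto intro!: mult_strict_right_mono mult_pos_pos)
    then show ?thesis using uw by (simp add: s_def)
  qed
  have c: "norm (c t - x0) \<le> s t" if "t \<in> {0..1}" for t
  proof -
    have "norm (c t - x0) \<le> norm (x - x0) + norm (t *\<^sub>R (y - x))"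
      using norm_triangle_ineq[of "x - x0" "t *\<^sub>R (y - x)"] by (simp add: c_def algebra_simps)
    also have "\<dots> \<le> u + t * (w - u)"
      using that x y by (intro add_mono) (auto intro: mult_left_mono)
    finally show ?thesis by (simp add: s_def)
  qed
  have c_in: "c t \<in> cball x0 R" if "t \<in> {0..1}" for t
    using c[OF that] s[OF that] by (simp add: dist_norm norm_minus_commute)
  have dT: "(?T \<circ> c has_vector_derivative ((y - x) - B (F' (c t) (y - x)))) (at t)"
    if "t \<in> {0..1}" for t
  proof -
    have "(?T has_derivative (\<lambda>h. h - B (F' (c t) h))) (at (c t))"
      unfolding fixed_point_map_def
      by (intro has_derivative_diff has_derivative_ident 
          bounded_linear.has_derivative[OF blinfun.bounded_linear_right der[OF c_in[OF that]]])
    moreover have "(c has_vector_derivative (y - x)) (at t)"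
      unfolding c_def by (auto intro!: derivative_eq_intros)
    ultimately show ?thesis
      using vector_derivative_diff_chain_within has_derivative_at_withinI by fast
  qed
  have ds: "(s has_real_derivative (w - u)) (at t within A)" for t A
    unfolding s_def by (auto intro!: derivative_eq_intros)
  have dm: "(?m \<circ> s has_vector_derivative (\<omega> (s t) * (w - u))) (at t)" if "t \<in> {0<..<1}" for t
  proof -
    have "(?m has_real_derivative \<omega> (s t)) (at (s t))"
      using majorant_has_derivative[OF cont, of "s t" \<nu> \<eta>] s_in[OF that]
        at_within_interior[of "s t" "{0..R}"] by auto
    from DERIV_chain[OF this ds] show ?thesis
      by (simp add: has_real_derivative_iff_has_vector_derivative)
  qed
  have "norm ((?T \<circ> c) 1 - (?T \<circ> c) 0) \<le> (?m \<circ> s) 1 - (?m \<circ> s) 0"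
  proof (rule differentiable_bound_general[of 0 1 "?T \<circ> c" "?m \<circ> s"
        "\<lambda>t. (y - x) - B (F' (c t) (y - x))" "\<lambda>t. \<omega> (s t) * (w - u)"])
    show "continuous_on {0..1} (?T \<circ> c)"
      by (rule continuous_on_vector_derivative) (use dT has_vector_derivative_at_within in blast)
    have "continuous_on {0..R} ?m"
      using majorant_has_derivative[OF cont] by (rule DERIV_continuous_on)
    then have "continuous_on (s ` {0..1}) ?m"
      by (rule continuous_on_subset) (use s in auto)
    then show "continuous_on {0..1} (?m \<circ> s)"
      by (intro continuous_on_compose DERIV_continuous_on[OF ds])
    fix t :: real assume t: "0 < t" "t < 1"
    then have t': "t \<in> {0..1}" by simp
    have "norm ((y - x) - B (F' (c t) (y - x))) = norm (((B o\<^sub>L F' (c t)) - id_blinfun) (y - x))"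
      by (simp add: blinfun.diff_left norm_minus_commute)
    also have "\<dots> \<le> norm ((B o\<^sub>L F' (c t)) - id_blinfun) * norm (y - x)"
      by (rule norm_blinfun)
    also have "\<dots> \<le> \<omega> (s t) * (w - u)"
    proof (rule mult_mono)
      have "\<omega> (norm (c t - x0)) \<le> \<omega> (s t)"
        using c[OF t'] s[OF t'] by (intro mono_onD[OF mono]) auto
      then show "norm ((B o\<^sub>L F' (c t)) - id_blinfun) \<le> \<omega> (s t)"
        using bound[OF c_in[OF t']] by linarith
    qed (use y nonneg s[OF t'] in auto)
    finally show "norm ((y - x) - B (F' (c t) (y - x))) \<le> \<omega> (s t) * (w - u)" .
  qed (use dT dm in auto)
  then show ?thesis by (simp add: c_def s_def)
qed

lemma gamma_star_bounds:
  assumes "continuous_on {0..R} \<omega>" "\<omega> 0 < 1" "0 < R"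
  shows "0 < gamma_star \<omega> R" "gamma_star \<omega> R \<le> R"
proof -
  let ?G = "{\<gamma>. 0 < \<gamma> \<and> \<gamma> \<le> R \<and> \<omega> \<gamma> < 1}"
  have "0 \<in> {0..R}" "0 < 1 - \<omega> 0" using assms by auto
  then obtain d where d: "d > 0" "\<And>l. \<lbrakk>l \<in> {0..R}; dist l 0 < d\<rbrakk> \<Longrightarrow> dist (\<omega> l) (\<omega> 0) < 1 - \<omega> 0"
    using assms(1)[unfolded continuous_on_iff] by blast
  have "\<omega> (min (d / 2) R) < 1"
    using d(2)[of "min (d / 2) R"] \<open>d > 0\<close> assms(3) by (auto simp: dist_real_def abs_less_iff)
  then have m: "min (d / 2) R \<in> ?G"
    using \<open>d > 0\<close> assms(3) unfolding mem_Collect_eq by (intro conjI) auto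
  have "bdd_above ?G" by (rule bdd_aboveI[of _ R]) simp
  with m have "min (d / 2) R \<le> gamma_star \<omega> R"
    unfolding gamma_star_def by (rule cSup_upper)
  then show "0 < gamma_star \<omega> R" using \<open>d > 0\<close> assms by linarith
  show "gamma_star \<omega> R \<le> R"
    unfolding gamma_star_def
  proof (rule cSup_least)
    show "?G \<noteq> {}" using m by blast
  qed simp
qed

lemma lambda_star_properties:
  assumes "v \<le> R"
  shows "v \<le> lambda_star \<phi> R v" "lambda_star \<phi> R v \<le> R"
    and "\<lbrakk>v < u; u < lambda_star \<phi> R v\<rbrakk> \<Longrightarrow> \<phi> u < u"
proof -
  let ?L = "Lambda_set \<phi> R v"
  have bdd: "bdd_above ?L" by (rule bdd_aboveI[of _ R]) (simp add: Lambda_set_def)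
  show "v \<le> lambda_star \<phi> R v"
  proof (cases "?L = {}")
    case False
    then obtain l where l: "l \<in> ?L" by blast
    then have "v < l" by (simp add: Lambda_set_def)
    also have "l \<le> Sup ?L" using cSup_upper[OF l bdd] .
    finally show ?thesis using False by (simp add: lambda_star_def)
  qed (simp add: lambda_star_def)
  show "lambda_star \<phi> R v \<le> R"
  proof (cases "?L = {}")
    case False
    then have "Sup ?L \<le> R" by (rule cSup_least) (simp add: Lambda_set_def)
    then show ?thesis using False by (simp add: lambda_star_def)
  qed (simp add: lambda_star_def assms)
  show "\<phi> u < u" if u: "v < u" "u < lambda_star \<phi> R v"
  proof -
    have ne: "?L \<noteq> {}"
      using less_trans[OF u] by (auto simp: lambda_star_def)
    then have "u < Sup ?L" using u(2) by (simp add: lambda_star_def)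
    then obtain l where "l \<in> ?L" "u < l"
      using less_cSup_iff[OF ne bdd] by blast
    then show ?thesis using u(1) by (simp add: Lambda_set_def)
  qed
qed

section \<open>The convergence theorem\<close>

lemma fixed_point_map_eq_self_iff: "fixed_point_map B F x = x \<longleftrightarrow> blinfun_apply B (F x) = 0"
  by (simp add: fixed_point_map_def)

text \<open>A solution is a constant orbit, so uniqueness is part of attraction.\<close>

lemma unique_solution_if_attracting:
  assumes attr: "\<And>y. y \<in> U \<Longrightarrow> iterates_converge_in (fixed_point_map B F) D y p"
    and "p \<in> U" "solution B F D p"
  shows "unique_solution_in B F D U p"
proof -
  have "y = p" if "y \<in> U" "solution B F D y" for y
  proof -
    have "fixed_point_map B F y = y"
      using that by (simp add: fixed_point_map_eq_self_iff solution_def)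
    then have "(fixed_point_map B F ^^ k) y = y" for k
      by (induction k) auto
    with attr[OF that(1)] show ?thesis
      by (simp add: iterates_converge_in_def LIMSEQ_const_iff)
  qed
  with assms(2,3) show ?thesis unfolding unique_solution_in_def by blast
qed


theorem mainTheorem1:
  fixes D\<^sub>F :: "'a::banach set"
    and F :: "'a \<Rightarrow> 'b::banach"
    and F' :: "'a \<Rightarrow> 'a \<Rightarrow>\<^sub>L 'b"
    and B :: "'b \<Rightarrow>\<^sub>L 'a"
    and x\<^sub>0 :: 'a
    and \<eta> \<nu> R :: real
    and \<omega> :: "real \<Rightarrow> real"
  defines "T \<equiv> fixed_point_map B F"
    and "\<phi> \<equiv> majorant \<omega> \<nu> \<eta>"
  assumes "open D\<^sub>F"
    and "C1_on_with_derivative F F' D\<^sub>F"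
    and "invertible_blinfun B"
    and "x\<^sub>0 \<in> D\<^sub>F"
    and "\<eta> > 0" and "0 \<le> \<nu>" and "\<nu> < 1" and "R > 0"
    and "cball x\<^sub>0 R \<subseteq> D\<^sub>F"
    and "\<forall>l\<in>{0..R}. \<omega> l \<ge> 0"
    and "continuous_on {0..R} \<omega>"
    and "mono_on {0..R} \<omega>"
    and "\<omega> 0 = \<nu>"
    and "\<forall>x\<in>cball x\<^sub>0 R. norm ((B o\<^sub>L F' x) - id_blinfun) \<le> \<omega> (norm (x - x\<^sub>0))"
    and "norm (blinfun_apply B (F x\<^sub>0)) \<le> \<eta>"
    and "\<phi> (gamma_star \<omega> R) \<le> gamma_star \<omega> R"
  shows "\<exists>v\<^sub>s x\<^sub>s.
      least_fixpoint_in \<phi> {0..R} v\<^sub>s \<and> v\<^sub>s \<le> gamma_star \<omega> R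
    \<and> incseq (\<lambda>k. (\<phi> ^^ k) 0)
    \<and> (\<forall>k. (\<phi> ^^ k) 0 \<in> {0..v\<^sub>s})
    \<and> (\<lambda>k. (\<phi> ^^ k) 0) \<longlonglongrightarrow> v\<^sub>s
    \<and> iterates_converge_in T D\<^sub>F x\<^sub>0 x\<^sub>s
    \<and> (\<forall>k. (T ^^ k) x\<^sub>0 \<in> cball x\<^sub>0 v\<^sub>s)
    \<and> solution B F D\<^sub>F x\<^sub>s
    \<and> (\<forall>k. norm ((T ^^ Suc k) x\<^sub>0 - (T ^^ k) x\<^sub>0) \<le> (\<phi> ^^ Suc k) 0 - (\<phi> ^^ k) 0
         \<and> norm (x\<^sub>s - (T ^^ k) x\<^sub>0) \<le> v\<^sub>s - (\<phi> ^^ k) 0)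
    \<and> (let l\<^sub>s = lambda_star \<phi> R v\<^sub>s in
         (l\<^sub>s = v\<^sub>s \<or> (l\<^sub>s > v\<^sub>s \<and> \<phi> l\<^sub>s < l\<^sub>s) \<longrightarrow>
            unique_solution_in B F D\<^sub>F (cball x\<^sub>0 l\<^sub>s) x\<^sub>s
            \<and> (\<forall>y\<in>cball x\<^sub>0 l\<^sub>s. iterates_converge_in T D\<^sub>F y x\<^sub>s))
       \<and> (l\<^sub>s > v\<^sub>s \<and> \<phi> l\<^sub>s = l\<^sub>s \<longrightarrow>
            unique_solution_in B F D\<^sub>F (ball x\<^sub>0 l\<^sub>s) x\<^sub>s
            \<and> (\<forall>y\<in>ball x\<^sub>0 l\<^sub>s. iterates_converge_in T D\<^sub>F y x\<^sub>s)))"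
proof -
  note asm = assms(3-)
  have der: "(F has_derivative blinfun_apply (F' x)) (at x)" if "x \<in> cball x\<^sub>0 R" for x
    using that asm(2,9) by (auto simp: C1_on_with_derivative_def)
  have \<phi>0: "\<phi> 0 = \<eta>" by (simp add: \<phi>_def majorant_def)
  interpret majorized_map T x\<^sub>0 \<phi> R
  proof
    show "norm (T y - T x) \<le> \<phi> w - \<phi> u"
      if "0 \<le> u" "u \<le> w" "w \<le> R" "norm (x - x\<^sub>0) \<le> u" "norm (y - x) \<le> w - u" for u w x y
      unfolding T_def \<phi>_def
      by (rule fixed_point_map_increment_le[OF der asm(11,12)]) (use asm(10,14) that in auto)
    show "norm (T x\<^sub>0 - x\<^sub>0) \<le> \<phi> 0"
      using asm(15) by (simp add: \<phi>0 T_def fixed_point_map_def)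
    show "continuous_on {0..R} \<phi>"
      unfolding \<phi>_def using majorant_has_derivative[OF asm(11)] by (rule DERIV_continuous_on)
  qed
  have g: "0 < gamma_star \<omega> R" "gamma_star \<omega> R \<le> R"
    using gamma_star_bounds[OF asm(11)] asm(7,8,13) by auto
  obtain v where v: "0 \<le> v" "v \<le> gamma_star \<omega> R" "\<phi> v = v"
      "\<And>u. \<lbrakk>0 \<le> u; u \<le> R; \<phi> u = u\<rbrakk> \<Longrightarrow> v \<le> u"
      "incseq (\<lambda>k. (\<phi> ^^ k) 0)" "\<And>k. 0 \<le> (\<phi> ^^ k) 0 \<and> (\<phi> ^^ k) 0 \<le> v"
      "(\<lambda>k. (\<phi> ^^ k) 0) \<longlonglongrightarrow> v"
    using scalar_iteration_converges[of "gamma_star \<omega> R"] g asm(16) by auto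
  have vR: "v \<le> R" using v(2) g(2) by linarith
  obtain p where p: "T p = p" "(\<lambda>k. (T ^^ k) x\<^sub>0) \<longlonglongrightarrow> p"
      "\<And>k. norm ((T ^^ k) x\<^sub>0 - x\<^sub>0) \<le> (\<phi> ^^ k) 0"
      "\<And>k. norm ((T ^^ Suc k) x\<^sub>0 - (T ^^ k) x\<^sub>0) \<le> (\<phi> ^^ Suc k) 0 - (\<phi> ^^ k) 0"
      "\<And>k. norm (p - (T ^^ k) x\<^sub>0) \<le> v - (\<phi> ^^ k) 0"
    using orbit_of_centre_converges[OF v(1) vR v(3) _ v(7)] v(6) by blast
  have in_v: "(T ^^ k) x\<^sub>0 \<in> cball x\<^sub>0 v" for k
    using p(3)[of k] v(6)[of k] by (simp add: dist_norm norm_minus_commute)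
  have p_in: "p \<in> cball x\<^sub>0 v"
    using p(5)[of 0] by (simp add: dist_norm norm_minus_commute)
  have sub: "cball x\<^sub>0 r \<subseteq> D\<^sub>F" if "r \<le> R" for r
    using asm(9) subset_cball[OF that, of x\<^sub>0] by blast
  have p_sol: "solution B F D\<^sub>F p"
    
    using p(1) p_in sub[OF vR] unfolding solution_def T_def fixed_point_map_eq_self_iff by blast
  have attract: "iterates_converge_in T D\<^sub>F y p"
    if "v \<le> w" "w \<le> R" "\<phi> w \<le> w" "\<And>u. \<lbrakk>v < u; u \<le> w\<rbrakk> \<Longrightarrow> \<phi> u \<noteq> u" "y \<in> cball x\<^sub>0 w" for w y
  proof -
    have "norm (y - x\<^sub>0) \<le> w"
      using that by (simp add: dist_norm norm_minus_commute)
    from orbits_converge[OF v(1,3,7) p(2) that(1-4) this] show ?thesis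
      using asm(9) by (auto simp: iterates_converge_in_def)
  qed
  define l where "l = lambda_star \<phi> R v"
  note l = lambda_star_properties[OF vR, where \<phi> = \<phi>, folded l_def]
  have closed_case: "iterates_converge_in T D\<^sub>F y p"
    if l': "l = v \<or> (l > v \<and> \<phi> l < l)" and y: "y \<in> cball x\<^sub>0 l" for y
  proof (rule attract[OF l(1,2) _ _ y])
    show "\<phi> l \<le> l" using l' v(3) by fastforce
    show "\<phi> u \<noteq> u" if "v < u" "u \<le> l" for u
    proof (cases "u = l")
      case True
      then show ?thesis using l' that by auto
    next
      case False
      then show ?thesis using l(3)[of u] that by linarith
    qed
  qed
  have open_case: "iterates_converge_in T D\<^sub>F y p" if "l > v" "y \<in> ball x\<^sub>0 l" for y
  proof -
    (* A radius below l that covers y; it must not be less than v. *)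
    define w where "w = max v (dist x\<^sub>0 y)"
    have w: "v \<le> w" "w < l" "y \<in> cball x\<^sub>0 w" using that by (auto simp: w_def)
    show ?thesis
    proof (rule attract[OF w(1) _ _ _ w(3)])
      show "w \<le> R" using w(2) l(2) by linarith
      show "\<phi> w \<le> w"
      proof (cases "v = w")
        case False
        then show ?thesis using l(3)[of w] w by linarith
      qed (use v(3) in simp)
      show "\<phi> u \<noteq> u" if "v < u" "u \<le> w" for u
        using l(3)[of u] that w(2) by linarith
    qed
  qed
  have p_l: "p \<in> cball x\<^sub>0 l" "l > v \<Longrightarrow> p \<in> ball x\<^sub>0 l"
    using p_in l(1) by simp_all
  have closed_unique: "unique_solution_in B F D\<^sub>F (cball x\<^sub>0 l) p" if "l = v \<or> (l > v \<and> \<phi> l < l)"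
    by (rule unique_solution_if_attracting[OF closed_case[OF that, unfolded T_def] p_l(1) p_sol])
  have open_unique: "unique_solution_in B F D\<^sub>F (ball x\<^sub>0 l) p" if "l > v"
    by (rule unique_solution_if_attracting[OF open_case[OF that, unfolded T_def] p_l(2)[OF that] p_sol])
  have "least_fixpoint_in \<phi> {0..R} v"
    unfolding least_fixpoint_in_def using v(1,3,4) vR by (metis atLeastAtMost_iff)
  moreover have "iterates_converge_in T D\<^sub>F x\<^sub>0 p"
    using in_v sub[OF vR] p(2) unfolding iterates_converge_in_def by blast
  moreover have "\<forall>k. (\<phi> ^^ k) 0 \<in> {0..v}" using v(6) by simp
  moreover have "\<forall>k. norm ((T ^^ Suc k) x\<^sub>0 - (T ^^ k) x\<^sub>0) \<le> (\<phi> ^^ Suc k) 0 - (\<phi> ^^ k) 0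
      \<and> norm (p - (T ^^ k) x\<^sub>0) \<le> v - (\<phi> ^^ k) 0"
    using p(4,5) by blast
  moreover have "(l = v \<or> (l > v \<and> \<phi> l < l) \<longrightarrow> unique_solution_in B F D\<^sub>F (cball x\<^sub>0 l) p
        \<and> (\<forall>y\<in>cball x\<^sub>0 l. iterates_converge_in T D\<^sub>F y p))
      \<and> (l > v \<and> \<phi> l = l \<longrightarrow> unique_solution_in B F D\<^sub>F (ball x\<^sub>0 l) p
        \<and> (\<forall>y\<in>ball x\<^sub>0 l. iterates_converge_in T D\<^sub>F y p))"
    using closed_case open_case closed_unique open_unique by blast
  moreover have "\<forall>k. (T ^^ k) x\<^sub>0 \<in> cball x\<^sub>0 v" using in_v by blast
  ultimately show ?thesis
    using v(2,5,7) p_sol unfolding Let_def l_def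
    by (intro exI[of _ v] exI[of _ p] conjI) (assumption | elim conjE, assumption)+
qed

end
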